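(* For all terms $s,t$ over $\Sigma_{SCL}(A)$ (with variables), $\mathrm{EqMSCL}\vdash s=t$ if and only if $\mathrm{MSCL}\vdash s=t$.
   Context: $A$ is a non-empty set of atoms. $\Sigma_{SCL}(A)=\{\land_s,\lor_s,\neg,\mathsf T,\mathsf F\}\cup A$ (sequential conjunction, sequential disjunction, negation, constants); $\vdash$ is equational-logic derivability. $\mathrm{EqMSCL}$ consists of (Neg) $\mathsf F=\neg\mathsf T$, (Or) $x\lor_s y=\neg(\neg x\land_s\neg y)$, (Tand) $\mathsf T\land_s x=x$, (Abs) $x\land_s(x\lor_s y)=x$, (Mem) $(x\lor_s y)\land_s z=(\neg x\land_s(y\land_s z))\lor_s(x\land_s z)$. Memorizing short-circuit logic $\mathrm{MSCL}$: for terms $s,t$ over $\Sigma_{SCL}(A)$, $\mathrm{MSCL}\vdash s=t$ means that $s=t$ is derivable from the following equations over the signature $\Sigma_{SCL}(A)$ extended with Hoare's ternary conditional $x\lhd y\rhd z$ (a hidden operator): (CP1) $x\lhd\mathsf T\rhd y=x$, (CP2) $x\lhd\mathsf F\rhd y=y$, (CP3) $\mathsf T\lhd x\rhd\mathsf F=x$, (CP4) $x\lhd(y\lhd z\rhd u)\rhd v=(x\lhd y\rhd v)\lhd z\rhd(x\lhd u\rhd v)$, (CPmem) $x\lhd y\rhd(z\lhd u\rhd(v\lhd y\rhd w))=x\lhd y\rhd(z\lhd u\rhd w)$, and $\neg x=\mathsf F\lhd x\rhd\mathsf T$, $x\land_s y=y\lhd x\rhd\mathsf F$, $x\lor_s y=\mathsf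 T\lhd x\rhd y$. *)

theory Defs imports Main
begin

text \<open>
  Terms over \<open>\<Sigma>\<^sub>S\<^sub>C\<^sub>L(A)\<close>. The set \<open>A\<close> of atoms is the type \<open>'a\<close> (non-empty, as every type is);
  atoms are constants, unaffected by substitution. Variables are drawn from the countably
  infinite supply \<open>nat\<close>.
\<close>

datatype 'a scl =
    SVar nat
  | SAtom 'a
  | STrue
  | SFalse
  | SNeg "'a scl"
  | SAnd "'a scl" "'a scl"  (infixl \<open>\<and>\<^sub>s\<close> 70)
  | SOr "'a scl" "'a scl"  (infixl \<open>\<or>\<^sub>s\<close> 65)

primrec scl_subst :: "(nat \<Rightarrow> 'a scl) \<Rightarrow> 'a scl \<Rightarrow> 'a scl" where
  "scl_subst \<sigma> (SVar n) = \<sigma> n"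
| "scl_subst \<sigma> (SAtom a) = SAtom a"
| "scl_subst \<sigma> STrue = STrue"
| "scl_subst \<sigma> SFalse = SFalse"
| "scl_subst \<sigma> (SNeg s) = SNeg (scl_subst \<sigma> s)"
| "scl_subst \<sigma> (s \<and>\<^sub>s t) = scl_subst \<sigma> s \<and>\<^sub>s scl_subst \<sigma> t"
| "scl_subst \<sigma> (s \<or>\<^sub>s t) = scl_subst \<sigma> s \<or>\<^sub>s scl_subst \<sigma> t"

text \<open>Equational logic: every term in a derivation is a term over \<open>\<Sigma>\<^sub>S\<^sub>C\<^sub>L(A)\<close>.\<close>

inductive scl_derives :: "('a scl \<times> 'a scl) set \<Rightarrow> 'a scl \<Rightarrow> 'a scl \<Rightarrow> bool"
  for E where
  scl_axiom: "(s, t) \<in> E \<Longrightarrow> scl_derives E s t"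
| scl_refl: "scl_derives E s s"
| scl_sym: "scl_derives E s t \<Longrightarrow> scl_derives E t s"
| scl_trans: "scl_derives E s t \<Longrightarrow> scl_derives E t u \<Longrightarrow> scl_derives E s u"
| scl_inst: "scl_derives E s t \<Longrightarrow> scl_derives E (scl_subst \<sigma> s) (scl_subst \<sigma> t)"
| scl_cong_neg: "scl_derives E s t \<Longrightarrow> scl_derives E (SNeg s) (SNeg t)"
| scl_cong_and: "scl_derives E s s' \<Longrightarrow> scl_derives E t t' \<Longrightarrow>
    scl_derives E (s \<and>\<^sub>s t) (s' \<and>\<^sub>s t')"
| scl_cong_or: "scl_derives E s s' \<Longrightarrow> scl_derives E t t' \<Longrightarrow>
    scl_derives E (s \<or>\<^sub>s t) (s' \<or>\<^sub>s t')"

definition EqMSCL :: "('a scl \<times> 'a scl) set" where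
  "EqMSCL = (let x = SVar 0; y = SVar 1; z = SVar 2 in
    { \<comment> \<open>Neg\<close> (SFalse, SNeg STrue),
      \<comment> \<open>Or\<close> (x \<or>\<^sub>s y, SNeg (SNeg x \<and>\<^sub>s SNeg y)),
      \<comment> \<open>Tand\<close> (STrue \<and>\<^sub>s x, x),
      \<comment> \<open>Abs\<close> (x \<and>\<^sub>s (x \<or>\<^sub>s y), x),
      \<comment> \<open>Mem\<close> ((x \<or>\<^sub>s y) \<and>\<^sub>s z, (SNeg x \<and>\<^sub>s (y \<and>\<^sub>s z)) \<or>\<^sub>s (x \<and>\<^sub>s z)) })"

text \<open>
  Terms over \<open>\<Sigma>\<^sub>S\<^sub>C\<^sub>L(A)\<close> extended with Hoare's conditional; \<open>x \<lhd> y \<rhd> z\<close> reads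
  ``if \<open>y\<close> then \<open>x\<close> else \<open>z\<close>''.
\<close>

datatype 'a cscl =
    CVar nat
  | CAtom 'a
  | CTrue
  | CFalse
  | CNeg "'a cscl"
  | CAnd "'a cscl" "'a cscl"  (infixl \<open>\<and>\<^sub>c\<close> 70)
  | COr "'a cscl" "'a cscl"  (infixl \<open>\<or>\<^sub>c\<close> 65)
  | Cond "'a cscl" "'a cscl" "'a cscl"  (\<open>_ \<lhd> _ \<rhd> _\<close> [61, 61, 61] 60)

primrec cscl_subst :: "(nat \<Rightarrow> 'a cscl) \<Rightarrow> 'a cscl \<Rightarrow> 'a cscl" where
  "cscl_subst \<sigma> (CVar n) = \<sigma> n"
| "cscl_subst \<sigma> (CAtom a) = CAtom a"
| "cscl_subst \<sigma> CTrue = CTrue"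
| "cscl_subst \<sigma> CFalse = CFalse"
| "cscl_subst \<sigma> (CNeg s) = CNeg (cscl_subst \<sigma> s)"
| "cscl_subst \<sigma> (s \<and>\<^sub>c t) = cscl_subst \<sigma> s \<and>\<^sub>c cscl_subst \<sigma> t"
| "cscl_subst \<sigma> (s \<or>\<^sub>c t) = cscl_subst \<sigma> s \<or>\<^sub>c cscl_subst \<sigma> t"
| "cscl_subst \<sigma> (s \<lhd> t \<rhd> u) = cscl_subst \<sigma> s \<lhd> cscl_subst \<sigma> t \<rhd> cscl_subst \<sigma> u"

inductive cscl_derives :: "('a cscl \<times> 'a cscl) set \<Rightarrow> 'a cscl \<Rightarrow> 'a cscl \<Rightarrow> bool"
  for E where
  cscl_axiom: "(s, t) \<in> E \<Longrightarrow> cscl_derives E s t"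
| cscl_refl: "cscl_derives E s s"
| cscl_sym: "cscl_derives E s t \<Longrightarrow> cscl_derives E t s"
| cscl_trans: "cscl_derives E s t \<Longrightarrow> cscl_derives E t u \<Longrightarrow> cscl_derives E s u"
| cscl_inst: "cscl_derives E s t \<Longrightarrow> cscl_derives E (cscl_subst \<sigma> s) (cscl_subst \<sigma> t)"
| cscl_cong_neg: "cscl_derives E s t \<Longrightarrow> cscl_derives E (CNeg s) (CNeg t)"
| cscl_cong_and: "cscl_derives E s s' \<Longrightarrow> cscl_derives E t t' \<Longrightarrow>
    cscl_derives E (s \<and>\<^sub>c t) (s' \<and>\<^sub>c t')"
| cscl_cong_or: "cscl_derives E s s' \<Longrightarrow> cscl_derives E t t' \<Longrightarrow>
    cscl_derives E (s \<or>\<^sub>c t) (s' \<or>\<^sub>c t')"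
| cscl_cong_cond: "cscl_derives E s s' \<Longrightarrow> cscl_derives E t t' \<Longrightarrow> cscl_derives E u u' \<Longrightarrow>
    cscl_derives E (s \<lhd> t \<rhd> u) (s' \<lhd> t' \<rhd> u')"

definition MSCL_axioms :: "('a cscl \<times> 'a cscl) set" where
  "MSCL_axioms =
    (let x = CVar 0; y = CVar 1; z = CVar 2; u = CVar 3; v = CVar 4; w = CVar 5 in
    { \<comment> \<open>CP1\<close> (x \<lhd> CTrue \<rhd> y, x),
      \<comment> \<open>CP2\<close> (x \<lhd> CFalse \<rhd> y, y),
      \<comment> \<open>CP3\<close> (CTrue \<lhd> x \<rhd> CFalse, x),
      \<comment> \<open>CP4\<close> (x \<lhd> (y \<lhd> z \<rhd> u) \<rhd> v, (x \<lhd> y \<rhd> v) \<lhd> z \<rhd> (x \<lhd> u \<rhd> v)),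
      \<comment> \<open>CPmem\<close> (x \<lhd> y \<rhd> (z \<lhd> u \<rhd> (v \<lhd> y \<rhd> w)), x \<lhd> y \<rhd> (z \<lhd> u \<rhd> w)),
      \<comment> \<open>negation\<close> (CNeg x, CFalse \<lhd> x \<rhd> CTrue),
      \<comment> \<open>conjunction\<close> (x \<and>\<^sub>c y, y \<lhd> x \<rhd> CFalse),
      \<comment> \<open>disjunction\<close> (x \<or>\<^sub>c y, CTrue \<lhd> x \<rhd> y) })"

text \<open>The inclusion of terms over \<open>\<Sigma>\<^sub>S\<^sub>C\<^sub>L(A)\<close> into terms over the extended signature.\<close>

primrec scl_incl :: "'a scl \<Rightarrow> 'a cscl" where
  "scl_incl (SVar n) = CVar n"
| "scl_incl (SAtom a) = CAtom a"
| "scl_incl STrue = CTrue"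
| "scl_incl SFalse = CFalse"
| "scl_incl (SNeg s) = CNeg (scl_incl s)"
| "scl_incl (s \<and>\<^sub>s t) = scl_incl s \<and>\<^sub>c scl_incl t"
| "scl_incl (s \<or>\<^sub>s t) = scl_incl s \<or>\<^sub>c scl_incl t"

definition EqMSCL_proves :: "'a scl \<Rightarrow> 'a scl \<Rightarrow> bool" where
  "EqMSCL_proves s t \<longleftrightarrow> scl_derives EqMSCL s t"

text \<open>The conditional is hidden: \<open>s\<close> and \<open>t\<close> do not contain it, but derivations may.\<close>

definition MSCL_proves :: "'a scl \<Rightarrow> 'a scl \<Rightarrow> bool" where
  "MSCL_proves s t \<longleftrightarrow> cscl_derives MSCL_axioms (scl_incl s) (scl_incl t)"

end

theory Submission imports Defs begin

text \<open>
  Each axiom system interprets the other. The equations of EqMSCL follow from CP1--CP4 and CPmem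
  by evaluating conditionals. Conversely, over EqMSCL the term
  \<open>(y \<and>\<^sub>s x) \<or>\<^sub>s (\<not> y \<and>\<^sub>s z)\<close> behaves as \<open>x \<lhd> y \<rhd> z\<close>. The crucial consequences of EqMSCL
  for this are associativity, left distributivity, and the equality of this term with
  \<open>(\<not> y \<or>\<^sub>s x) \<and>\<^sub>s (y \<or>\<^sub>s z)\<close>, which makes the conditional commute with negation and with
  conjunction on the right. Hence the term algebra of either system modulo derivability is a model
  of the other, and in this model a term evaluates to its own class.
\<close>

section \<open>Equational consequences of EqMSCL\<close>

locale mscl_algebra =
  fixes tr fa :: 'b and ng :: "'b \<Rightarrow> 'b" (\<open>\<ominus> _\<close> [80] 80)
    and cj :: "'b \<Rightarrow> 'b \<Rightarrow> 'b" (infixl \<open>\<sqinter>\<close> 70)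
    and dj :: "'b \<Rightarrow> 'b \<Rightarrow> 'b" (infixl \<open>\<squnion>\<close> 65)
  assumes Neg: "fa = \<ominus> tr"
    and Or: "x \<squnion> y = \<ominus> (\<ominus> x \<sqinter> \<ominus> y)"
    and Tand: "tr \<sqinter> x = x"
    and Abs: "x \<sqinter> (x \<squnion> y) = x"
    and Mem: "(x \<squnion> y) \<sqinter> z = (\<ominus> x \<sqinter> (y \<sqinter> z)) \<squnion> (x \<sqinter> z)"
begin

section \<open>Double negation, De Morgan laws, units and idempotence\<close>

lemma ng_ng [simp]: "\<ominus> \<ominus> x = x"
  \<comment> \<open>\<open>Abs\<close> at \<open>tr\<close> gives
    \<open>tr \<squnion> y = tr\<close>, hence
    \<open>\<ominus> (fa \<sqinter> \<ominus> u) = tr\<close>. \<open>Mem\<close> at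
    \<open>tr\<close> gives \<open>z = (fa \<sqinter> z) \<squnion> z\<close>: by \<open>Or\<close>
    every element is a negation, and for \<open>z = \<ominus> u\<close> the equation becomes
    \<open>\<ominus> u = \<ominus> \<ominus> \<ominus> u\<close>.\<close>
  by (metis Neg Or Tand Abs Mem)

lemma fa_dj: "fa \<squnion> x = x"
  by (simp add: Or Neg Tand)

lemma fa_cj: "fa \<sqinter> x = fa"
  by (metis Abs fa_dj)

lemma ng_dj: "\<ominus> (x \<squnion> y) = \<ominus> x \<sqinter> \<ominus> y"
  by (simp add: Or)

lemma ng_cj: "\<ominus> (x \<sqinter> y) = \<ominus> x \<squnion> \<ominus> y"
  by (simp add: Or)

lemma dj_absorb: "x \<squnion> (x \<sqinter> y) = x"
  by (metis Or Abs ng_ng)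

lemma Mem_dual: "(x \<sqinter> y) \<squnion> z = (\<ominus> x \<squnion> (y \<squnion> z)) \<sqinter> (x \<squnion> z)"
  by (metis Or Mem ng_ng)

lemma cj_tr: "x \<sqinter> tr = x"
  by (metis Neg Or Tand Mem ng_ng fa_cj)

lemma dj_fa: "x \<squnion> fa = x"
  by (metis Neg Or ng_ng cj_tr)

lemma cj_idem: "x \<sqinter> x = x"
  by (metis Abs dj_fa)

lemma dj_idem: "x \<squnion> x = x"
  by (metis Or ng_ng cj_idem)

section \<open>A term next to its own negation\<close>

lemma ng_dj_cj_self: "(\<ominus> x \<squnion> y) \<sqinter> x = x \<sqinter> y"
  using Mem_dual[of x y fa] by (simp add: dj_fa)

lemma cj_dj_ng_self: "(x \<sqinter> y) \<squnion> \<ominus> x = \<ominus> x \<squnion> y"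
  using ng_dj_cj_self[of x "\<ominus> y"] by (metis ng_ng ng_cj ng_dj)

lemma ng_cj_self: "\<ominus> x \<sqinter> x = x \<sqinter> \<ominus> x"
  using ng_dj_cj_self[of x "\<ominus> x"] by (simp add: dj_idem)

lemma cj_ng_self: "x \<sqinter> \<ominus> x = x \<sqinter> fa"
  using ng_dj_cj_self[of x fa] by (simp add: dj_fa ng_cj_self)

lemma ng_cj_fa: "\<ominus> x \<sqinter> fa = x \<sqinter> fa"
  by (metis cj_ng_self ng_cj_self ng_ng)

lemma cj_ng_cj: "x \<sqinter> (\<ominus> x \<sqinter> y) = x \<sqinter> fa"
proof -
  \<comment> \<open>By \<open>Abs\<close> the negated conjunction is just
    \<open>\<ominus> x\<close>, while \<open>\<ominus> (x \<squnion> \<ominus> y)\<close> is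
    \<open>\<ominus> x \<sqinter> y\<close>.\<close>
  have "\<ominus> (x \<sqinter> (x \<squnion> \<ominus> y)) \<sqinter> x = x \<sqinter> \<ominus> (x \<squnion> \<ominus> y)"
    by (simp only: ng_cj ng_dj_cj_self)
  then show ?thesis by (simp add: Abs ng_dj ng_cj_self cj_ng_self)
qed

lemma ng_cj_cj: "\<ominus> x \<sqinter> (x \<sqinter> y) = x \<sqinter> fa"
  using cj_ng_cj[of "\<ominus> x" y] by (simp add: ng_cj_fa)

text \<open>\<open>x \<sqinter> fa\<close> evaluates \<open>x\<close> and then fails, so any term that evaluates \<open>x\<close> first absorbs it.
  Until associativity is available this replaces a case distinction on \<open>x\<close>.\<close>

lemma cj_fa_dj: "(x \<sqinter> fa) \<squnion> (x \<sqinter> y) = x \<sqinter> y"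
  using Mem[of x fa y, symmetric] by (simp add: dj_fa fa_cj ng_cj_fa)

lemma cj_fa_dj_ng: "(x \<sqinter> fa) \<squnion> \<ominus> x = \<ominus> x"
  using cj_fa_dj[of "\<ominus> x" tr] by (simp add: cj_tr ng_cj_fa)

lemma cj_fa_cj_ng: "(x \<sqinter> fa) \<sqinter> \<ominus> x = x \<sqinter> fa"
proof -
  have "\<ominus> (x \<sqinter> fa) \<sqinter> x = x"
    using cj_fa_dj_ng[of x] by (metis ng_dj ng_ng)
  then show ?thesis
    by (metis Abs ng_cj ng_ng)
qed

lemma cj_fa_cj_fa: "(x \<sqinter> fa) \<sqinter> fa = x \<sqinter> fa"
proof -
  have "(x \<sqinter> fa) \<sqinter> x = x \<sqinter> fa"
    using cj_fa_cj_ng[of "\<ominus> x"] by (simp add: ng_cj_fa)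
  \<comment> \<open>With \<open>p = x \<sqinter> fa\<close>: \<open>p \<sqinter> x = p\<close> gives
    \<open>\<ominus> p \<squnion> \<ominus> x = \<ominus> p\<close>, so \<open>ng_dj_cj_self\<close>
    yields \<open>\<ominus> p \<sqinter> p = p \<sqinter> \<ominus> x = p\<close>.\<close>
  then have "\<ominus> (x \<sqinter> fa) \<sqinter> (x \<sqinter> fa) = x \<sqinter> fa"
    by (metis ng_dj_cj_self ng_cj cj_fa_cj_ng)
  then show ?thesis by (simp add: ng_cj_self cj_ng_self)
qed

lemma cj_fa_dj_ng_cj: "(x \<sqinter> fa) \<squnion> \<ominus> (x \<sqinter> y) = \<ominus> (x \<sqinter> y)"
proof -
  have "\<ominus> (x \<sqinter> fa) \<sqinter> \<ominus> (x \<sqinter> y) = \<ominus> (x \<sqinter> y)"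
    by (metis cj_fa_dj ng_dj)
  then show ?thesis
    using cj_fa_dj[of "\<ominus> (x \<sqinter> fa)" "\<ominus> (x \<sqinter> y)"] by (simp add: ng_cj_fa cj_fa_cj_fa)
qed

lemma ng_cj_fa_cj: "\<ominus> (x \<sqinter> fa) \<sqinter> (x \<sqinter> y) = x \<sqinter> y"
  by (metis cj_fa_dj_ng_cj ng_dj ng_ng)

lemma cj_dj_cj_fa: "(x \<sqinter> y) \<squnion> (x \<sqinter> fa) = x \<sqinter> y"
  using cj_dj_ng_self[of "\<ominus> (x \<sqinter> fa)" "x \<sqinter> y"] by (simp add: ng_cj_fa_cj cj_fa_dj)

lemma cj_cj_ng_cj_fa: "(x \<sqinter> y) \<sqinter> \<ominus> (x \<sqinter> fa) = x \<sqinter> y"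
proof -
  have "\<ominus> (x \<sqinter> fa) \<sqinter> \<ominus> (x \<sqinter> y) = \<ominus> (x \<sqinter> y)"
    by (metis cj_fa_dj ng_dj)
  then have "\<ominus> (x \<sqinter> y) \<squnion> (x \<sqinter> fa) = \<ominus> (x \<sqinter> y)"
    using cj_dj_ng_self[of "\<ominus> (x \<sqinter> fa)" "\<ominus> (x \<sqinter> y)"] by (simp add: cj_fa_dj_ng_cj)
  then show ?thesis by (metis ng_dj ng_ng)
qed

section \<open>Memory: repeated evaluation of the same term\<close>

lemma cj_dj_cj: "(x \<sqinter> y) \<squnion> (x \<sqinter> z) = x \<sqinter> (y \<squnion> (x \<sqinter> z))"
  using Mem_dual[of x y "x \<sqinter> z"] by (simp add: dj_absorb ng_dj_cj_self)

lemma cj_cj_left: "x \<sqinter> (x \<sqinter> y) = x \<sqinter> y"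
  using cj_dj_cj[of x fa y] by (simp add: cj_fa_dj fa_dj)

lemma cj_cj_right: "x \<sqinter> (y \<sqinter> x) = x \<sqinter> y"
  \<comment> \<open>\<open>Mem\<close> splits the left side of \<open>ng_dj_cj_self\<close>; its
    summand \<open>\<ominus> x \<sqinter> x\<close> is only \<open>x \<sqinter> fa\<close>, which is
    absorbed.\<close>
  using Mem[of "\<ominus> x" y x] by (simp add: ng_dj_cj_self ng_cj_self cj_ng_self cj_dj_cj_fa)

lemma cj_ng_dj: "x \<sqinter> (\<ominus> x \<squnion> y) = x \<sqinter> y"
  using cj_cj_right[of x "\<ominus> x \<squnion> y"] by (simp add: ng_dj_cj_self cj_cj_left)

lemma ng_cj_dj: "\<ominus> x \<sqinter> (x \<squnion> y) = \<ominus> x \<sqinter> y"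
  using cj_ng_dj[of "\<ominus> x" y] by simp

lemma dj_ng_cj: "x \<squnion> (\<ominus> x \<sqinter> y) = x \<squnion> y"
  using cj_ng_dj[of "\<ominus> x" "\<ominus> y"] by (metis ng_cj ng_dj ng_ng)

text \<open>In the \<open>Mem\<close> expansion of the inner term, the summand starting with
  \<open>\<ominus> x\<close> collapses to \<open>x \<sqinter> fa\<close> after
  \<open>x\<close>.\<close>

lemma cj_dj_cj_left: "x \<sqinter> ((x \<squnion> y) \<sqinter> z) = x \<sqinter> z"
  using cj_dj_cj[of x "\<ominus> x \<sqinter> (y \<sqinter> z)" z] by (simp add: Mem cj_ng_cj cj_fa_dj)

text \<open>Write \<open>w\<close> for \<open>x \<squnion> z\<close>. After \<open>x\<close>, a
  \<open>w\<close> may be inserted before \<open>y\<close>; then the last \<open>w\<close> goes by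
  \<open>cj_cj_right\<close>, and the inserted one is removed again.\<close>

lemma cj_cj_dj: "x \<sqinter> (y \<sqinter> (x \<squnion> z)) = x \<sqinter> y"
  by (metis cj_dj_cj_left cj_cj_right)

lemma ng_cj_dj_cj: "\<ominus> x \<sqinter> ((x \<squnion> y) \<sqinter> z) = \<ominus> x \<sqinter> (y \<sqinter> z)"
proof -
  \<comment> \<open>A conjunctive form of the \<open>Mem\<close> expansion: after
    \<open>\<ominus> x\<close> its last factor disappears by \<open>cj_cj_dj\<close>.\<close>
  have "(x \<squnion> (y \<sqinter> z)) \<sqinter> (\<ominus> x \<squnion> z) = (\<ominus> x \<sqinter> (y \<sqinter> z)) \<squnion> (x \<sqinter> z)"
    using cj_cj_dj[of "\<ominus> x" "y \<sqinter> z" z] by (simp add: Mem cj_ng_dj)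
  then have "(x \<squnion> y) \<sqinter> z = (x \<squnion> (y \<sqinter> z)) \<sqinter> (\<ominus> x \<squnion> z)"
    by (simp add: Mem)
  then show ?thesis
    by (simp add: cj_cj_dj ng_cj_dj)
qed

lemma cj_ng_dj_cj: "x \<sqinter> ((\<ominus> x \<squnion> y) \<sqinter> z) = x \<sqinter> (y \<sqinter> z)"
  using ng_cj_dj_cj[of "\<ominus> x" y z] by simp

text \<open>\<open>\<ominus> x \<squnion> (x \<sqinter> y)\<close> equals
  \<open>\<ominus> x \<squnion> y\<close>, so \<open>cj_ng_dj_cj\<close> does not distinguish
  \<open>y\<close> from \<open>x \<sqinter> y\<close>.\<close>

lemma cj_cj_cj: "x \<sqinter> ((x \<sqinter> y) \<sqinter> z) = x \<sqinter> (y \<sqinter> z)"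
  by (metis cj_ng_dj_cj cj_ng_dj ng_cj ng_ng)

section \<open>Associativity\<close>

lemma cj_cj_self: "(x \<sqinter> y) \<sqinter> x = x \<sqinter> y"
proof -
  have "(x \<sqinter> y) \<sqinter> \<ominus> (\<ominus> x \<sqinter> (x \<sqinter> y)) = (x \<sqinter> y) \<sqinter> x"
    by (metis cj_ng_dj cj_cj_right ng_cj ng_ng)
  then show ?thesis by (simp add: ng_cj_cj cj_cj_ng_cj_fa)
qed

lemma ng_dj_cj_cj: "(\<ominus> x \<squnion> y) \<sqinter> (x \<sqinter> z) = x \<sqinter> (y \<sqinter> (x \<sqinter> z))"
  by (simp add: Mem ng_cj_cj cj_dj_cj_fa)

lemma cj_cj_ng: "(x \<sqinter> y) \<sqinter> \<ominus> x = (x \<sqinter> y) \<sqinter> fa"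
  by (metis cj_cj_self cj_ng_dj cj_ng_self ng_cj)

lemma cj_cj_cj_fa: "(x \<sqinter> y) \<sqinter> (x \<sqinter> fa) = (x \<sqinter> y) \<sqinter> fa"
proof -
  \<comment> \<open>\<open>\<ominus> x \<squnion> x\<close> evaluates \<open>x\<close> and succeeds:
    it can precede \<open>x \<sqinter> y\<close> without effect, and its negation is
    \<open>x \<sqinter> fa\<close>. So \<open>cj_cj_ng\<close> is applied to it.\<close>
  have *: "(\<ominus> x \<squnion> x) \<sqinter> (x \<sqinter> y) = x \<sqinter> y"
    by (simp add: ng_dj_cj_cj cj_cj_left)
  have "\<ominus> (\<ominus> x \<squnion> x) = x \<sqinter> fa"
    by (simp add: ng_dj cj_ng_self)
  then show ?thesis
    using cj_cj_ng[of "\<ominus> x \<squnion> x" "x \<sqinter> y"] by (simp add: *)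
qed

lemma cj_cj_cj_fa_eq: "x \<sqinter> (y \<sqinter> (x \<sqinter> fa)) = (x \<sqinter> y) \<sqinter> fa"
proof -
  have "(x \<sqinter> y) \<sqinter> fa = \<ominus> (x \<sqinter> y) \<sqinter> (x \<sqinter> y)"
    by (simp add: ng_cj_self cj_ng_self)
  also have "\<dots> = x \<sqinter> (\<ominus> y \<sqinter> (x \<sqinter> y))"
    by (simp add: ng_cj ng_dj_cj_cj)
  finally have *: "x \<sqinter> ((x \<sqinter> y) \<sqinter> fa) = (x \<sqinter> y) \<sqinter> fa"
    by (simp add: cj_cj_left)
  have "x \<sqinter> (y \<sqinter> (x \<sqinter> fa)) = x \<sqinter> ((x \<sqinter> y) \<sqinter> (x \<sqinter> fa))"
    by (simp only: cj_cj_cj)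
  then show ?thesis by (simp only: cj_cj_cj_fa *)
qed

lemma cj_ng_cj_fa: "(x \<sqinter> \<ominus> y) \<sqinter> fa = (x \<sqinter> y) \<sqinter> fa"
proof -
  \<comment> \<open>The right side depends on \<open>y\<close> only through
    \<open>\<ominus> y \<sqinter> fa\<close>, which is the same for \<open>y\<close> and
    \<open>\<ominus> y\<close>.\<close>
  have "(x \<sqinter> y) \<sqinter> fa = (x \<sqinter> (\<ominus> y \<sqinter> fa)) \<squnion> (x \<sqinter> fa)" for y
    using ng_cj_fa[of "x \<sqinter> y"] by (simp add: ng_cj Mem ng_cj_fa)
  then show ?thesis by (simp add: ng_cj_fa)
qed

text \<open>\<open>\<ominus> x \<squnion> y\<close> also equals
  \<open>(x \<sqinter> y) \<squnion> \<ominus> x\<close>. Expanding both in front of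
  \<open>x \<sqinter> z\<close> by \<open>Mem\<close> produces the two sides, up to failing summands
  that are absorbed.\<close>

lemma cj_cj_cj_left: "(x \<sqinter> y) \<sqinter> (x \<sqinter> z) = x \<sqinter> (y \<sqinter> (x \<sqinter> z))"
proof -
  have *: "\<ominus> (x \<sqinter> y) \<sqinter> (x \<sqinter> fa) = (x \<sqinter> y) \<sqinter> fa"
    by (simp add: ng_cj ng_dj_cj_cj cj_cj_cj_fa_eq cj_ng_cj_fa)
  have "(\<ominus> x \<squnion> y) \<sqinter> (x \<sqinter> z) = ((x \<sqinter> y) \<squnion> \<ominus> x) \<sqinter> (x \<sqinter> z)"
    by (simp only: cj_dj_ng_self)
  also have "\<dots> = ((x \<sqinter> y) \<sqinter> fa) \<squnion> ((x \<sqinter> y) \<sqinter> (x \<sqinter> z))"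
    by (simp only: Mem ng_cj_cj *)
  finally show ?thesis by (simp add: ng_dj_cj_cj cj_fa_dj)
qed

text \<open>Since \<open>x \<sqinter> y\<close> remembers \<open>x\<close>, \<open>z\<close> may be
  replaced by \<open>x \<sqinter> z\<close>. Then \<open>cj_cj_cj_left\<close> shows that the left
  side begins with \<open>x\<close>, so another \<open>x\<close> may be put in front, and
  \<open>cj_cj_cj\<close> removes the inner one.\<close>

lemma cj_assoc: "(x \<sqinter> y) \<sqinter> z = x \<sqinter> (y \<sqinter> z)"
proof -
  have "(x \<sqinter> y) \<sqinter> z = (x \<sqinter> y) \<sqinter> (x \<sqinter> z)"
    using cj_cj_cj[of "x \<sqinter> y" x z] by (simp add: cj_cj_self cj_cj_left)
  then have *: "(x \<sqinter> y) \<sqinter> z = x \<sqinter> (y \<sqinter> (x \<sqinter> z))"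
    by (simp only: cj_cj_cj_left)
  then have "x \<sqinter> ((x \<sqinter> y) \<sqinter> z) = (x \<sqinter> y) \<sqinter> z"
    by (simp only: cj_cj_left)
  then show ?thesis by (simp only: cj_cj_cj)
qed

lemma dj_assoc: "(x \<squnion> y) \<squnion> z = x \<squnion> (y \<squnion> z)"
  by (simp add: Or cj_assoc)

section \<open>Left distributivity\<close>

lemma dj_dj_dj: "x \<squnion> (y \<squnion> (x \<squnion> z)) = x \<squnion> (y \<squnion> z)"
proof -
  have "x \<squnion> (y \<squnion> x) = x \<squnion> y"
    by (simp add: Or cj_cj_right)
  then show ?thesis by (metis dj_assoc)
qed

lemma cj_cj_cj_mem: "x \<sqinter> (y \<sqinter> (x \<sqinter> z)) = x \<sqinter> (y \<sqinter> z)"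
  by (metis cj_assoc cj_cj_right)

lemma cj_dj_distrib: "x \<sqinter> (y \<squnion> z) = (x \<sqinter> y) \<squnion> (x \<sqinter> z)"
proof -
  \<comment> \<open>What follows \<open>\<ominus> x\<close> in a disjunction is evaluated only if
    \<open>x\<close> holds, and there \<open>x \<sqinter> z\<close> and \<open>z\<close>
    agree.\<close>
  have "\<ominus> x \<squnion> (y \<squnion> (x \<sqinter> z)) = \<ominus> x \<squnion> (y \<squnion> z)"
    using dj_dj_dj[of "\<ominus> x" y "x \<sqinter> z"] dj_dj_dj[of "\<ominus> x" y z] dj_ng_cj[of "\<ominus> x" z]
    by simp
  then have "x \<sqinter> (y \<squnion> (x \<sqinter> z)) = x \<sqinter> (y \<squnion> z)"
    by (metis cj_ng_dj)
  then show ?thesis by (simp only: cj_dj_cj)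
qed

section \<open>The conditional as a defined operation\<close>

definition cond :: "'b \<Rightarrow> 'b \<Rightarrow> 'b \<Rightarrow> 'b" (\<open>_ \<triangleleft> _ \<triangleright> _\<close> [61, 61, 61] 60) where
  "x \<triangleleft> y \<triangleright> z = (y \<sqinter> x) \<squnion> (\<ominus> y \<sqinter> z)"

text \<open>\<open>Mem\<close> applied to \<open>\<ominus> y \<squnion> x\<close>: after
  \<open>y\<close> the second factor is absorbed, after \<open>\<ominus> y\<close> it reduces to
  \<open>z\<close>.\<close>

lemma cond_eq_cj: "x \<triangleleft> y \<triangleright> z = (\<ominus> y \<squnion> x) \<sqinter> (y \<squnion> z)"
  by (simp add: cond_def Mem ng_cj_dj cj_cj_dj)

lemma cj_cond: "y \<sqinter> (x \<triangleleft> y \<triangleright> z) = y \<sqinter> x"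
  by (simp add: cond_def cj_dj_distrib cj_cj_left cj_ng_cj) (simp add: cj_dj_cj_fa)

lemma ng_cj_cond: "\<ominus> y \<sqinter> (x \<triangleleft> y \<triangleright> z) = \<ominus> y \<sqinter> z"
  by (simp add: cond_eq_cj cj_dj_cj_left ng_cj_dj)

lemma ng_cond: "\<ominus> (x \<triangleleft> y \<triangleright> z) = \<ominus> x \<triangleleft> y \<triangleright> \<ominus> z"
  by (simp add: cond_eq_cj[of x] cond_def[of "\<ominus> x"] ng_dj ng_cj)

lemma cond_cj: "(x \<triangleleft> y \<triangleright> z) \<sqinter> w = (x \<sqinter> w) \<triangleleft> y \<triangleright> (z \<sqinter> w)"
proof -
  \<comment> \<open>Associativity lets \<open>cj_cj_dj\<close> remove \<open>y \<squnion> z\<close>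
    in front of \<open>w\<close>.\<close>
  have "y \<sqinter> (x \<sqinter> ((y \<squnion> z) \<sqinter> w)) = y \<sqinter> (x \<sqinter> w)"
    by (metis cj_assoc cj_cj_dj)
  then have "(\<ominus> y \<squnion> x) \<sqinter> ((y \<squnion> z) \<sqinter> w) = (x \<sqinter> w) \<triangleleft> y \<triangleright> (z \<sqinter> w)"
    by (simp only: Mem[of "\<ominus> y"] ng_ng ng_cj_dj_cj cond_def)
  then show ?thesis
    by (simp only: cond_eq_cj[of x] cj_assoc)
qed

lemma cond_dj: "(x \<triangleleft> y \<triangleright> z) \<squnion> w = (x \<squnion> w) \<triangleleft> y \<triangleright> (z \<squnion> w)"
  by (simp add: Or ng_cond cond_cj)

lemma ng_cj_cj_cond: "\<ominus> y \<sqinter> (p \<sqinter> (x \<triangleleft> y \<triangleright> z)) = \<ominus> y \<sqinter> (p \<sqinter> z)"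
  by (metis cj_cj_cj_mem ng_cj_cond)

text \<open>Each branch of the first conditional remembers \<open>y\<close>, so the second
  conditional reduces there to its matching value.\<close>

lemma cond_dj_cond: "(x \<triangleleft> y \<triangleright> z) \<squnion> (x' \<triangleleft> y \<triangleright> z') = (x \<squnion> x') \<triangleleft> y \<triangleright> (z \<squnion> z')"
proof -
  have "(x \<triangleleft> y \<triangleright> z) \<squnion> (x' \<triangleleft> y \<triangleright> z')
      = (y \<sqinter> (x \<squnion> (x' \<triangleleft> y \<triangleright> z'))) \<squnion> (\<ominus> y \<sqinter> (z \<squnion> (x' \<triangleleft> y \<triangleright> z')))"
    by (simp only: cond_dj) (simp only: cond_def[of "_ \<squnion> _"])
  also have "\<dots> = (y \<sqinter> (x \<squnion> x')) \<squnion> (\<ominus> y \<sqinter> (z \<squnion> z'))"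
    by (simp only: cj_dj_distrib cj_cond ng_cj_cond)
  finally show ?thesis by (simp only: cond_def)
qed

section \<open>Evaluation and soundness for EqMSCL\<close>

primrec eval :: "('a \<Rightarrow> 'b) \<Rightarrow> (nat \<Rightarrow> 'b) \<Rightarrow> 'a scl \<Rightarrow> 'b" where
  "eval \<alpha> \<rho> (SVar n) = \<rho> n"
| "eval \<alpha> \<rho> (SAtom a) = \<alpha> a"
| "eval \<alpha> \<rho> STrue = tr"
| "eval \<alpha> \<rho> SFalse = fa"
| "eval \<alpha> \<rho> (SNeg s) = \<ominus> eval \<alpha> \<rho> s"
| "eval \<alpha> \<rho> (SAnd s t) = eval \<alpha> \<rho> s \<sqinter> eval \<alpha> \<rho> t"
| "eval \<alpha> \<rho> (SOr s t) = eval \<alpha> \<rho> s \<squnion> eval \<alpha> \<rho> t"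

lemma eval_subst: "eval \<alpha> \<rho> (scl_subst \<sigma> s) = eval \<alpha> (\<lambda>n. eval \<alpha> \<rho> (\<sigma> n)) s"
  by (induction s) simp_all

lemma eval_sound: "scl_derives EqMSCL s t \<Longrightarrow> eval \<alpha> \<rho> s = eval \<alpha> \<rho> t"
\<comment> \<open>\<open>\<rho>\<close> is generalised because the substitution rule moves to the
  valuation \<open>\<lambda>n. eval \<alpha> \<rho> (\<sigma> n)\<close>.\<close>
proof (induction arbitrary: \<rho> rule: scl_derives.induct)
  case (scl_axiom s t)
  then show ?case
    by (auto simp: EqMSCL_def Let_def intro: Neg Or Tand Abs Mem)
qed (simp_all add: eval_subst)

end

section \<open>The conditional\<close>

locale cp_algebra =
  fixes tr fa :: 'b and ng :: "'b \<Rightarrow> 'b" (\<open>\<ominus> _\<close> [80] 80)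
    and cj :: "'b \<Rightarrow> 'b \<Rightarrow> 'b" (infixl \<open>\<sqinter>\<close> 70)
    and dj :: "'b \<Rightarrow> 'b \<Rightarrow> 'b" (infixl \<open>\<squnion>\<close> 65)
    and cond :: "'b \<Rightarrow> 'b \<Rightarrow> 'b \<Rightarrow> 'b" (\<open>_ \<triangleleft> _ \<triangleright> _\<close> [61, 61, 61] 60)
  assumes CP1: "x \<triangleleft> tr \<triangleright> y = x"
    and CP2: "x \<triangleleft> fa \<triangleright> y = y"
    and CP3: "tr \<triangleleft> x \<triangleright> fa = x"
    and CP4: "x \<triangleleft> (y \<triangleleft> z \<triangleright> u) \<triangleright> v = (x \<triangleleft> y \<triangleright> v) \<triangleleft> z \<triangleright> (x \<triangleleft> u \<triangleright> v)"
    and CPmem: "x \<triangleleft> y \<triangleright> (z \<triangleleft> u \<triangleright> (v \<triangleleft> y \<triangleright> w)) = x \<triangleleft> y \<triangleright> (z \<triangleleft> u \<triangleright> w)"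
    and ng_eq: "\<ominus> x = fa \<triangleleft> x \<triangleright> tr"
    and cj_eq: "x \<sqinter> y = y \<triangleleft> x \<triangleright> fa"
    and dj_eq: "x \<squnion> y = tr \<triangleleft> x \<triangleright> y"
begin

section \<open>The EqMSCL axioms from the conditional\<close>

lemma cond_ng: "x \<triangleleft> \<ominus> y \<triangleright> z = z \<triangleleft> y \<triangleright> x"
  by (simp add: ng_eq CP4 CP1 CP2)

lemma CPmem_right: "x \<triangleleft> y \<triangleright> (v \<triangleleft> y \<triangleright> w) = x \<triangleleft> y \<triangleright> w"
  using CPmem[of x y _ fa v w] by (simp add: CP2)

text \<open>\<open>CPmem_right\<close> with the guard negated, which swaps the branches.\<close>

lemma CPmem_left: "(x \<triangleleft> y \<triangleright> v) \<triangleleft> y \<triangleright> w = x \<triangleleft> y \<triangleright> w"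
  using CPmem_right[of w "\<ominus> y" v x] by (simp add: cond_ng)

lemma CPmem_deep: "x \<triangleleft> y \<triangleright> ((z \<triangleleft> u \<triangleright> (v \<triangleleft> y \<triangleright> w)) \<triangleleft> u' \<triangleright> w') = x \<triangleleft> y \<triangleright> ((z \<triangleleft> u \<triangleright> w) \<triangleleft> u' \<triangleright> w')"
proof -
  have *: "x \<triangleleft> y \<triangleright> ((v \<triangleleft> y \<triangleright> q) \<triangleleft> u' \<triangleright> w') = x \<triangleleft> y \<triangleright> (q \<triangleleft> u' \<triangleright> w')" for v q
    using CPmem[of x y w' "\<ominus> u'" v q] by (simp add: cond_ng)
  show ?thesis
    \<comment> \<open>Insert a conditional on \<open>y\<close> around the nested one by
      \<open>*\<close>, simplify inside it by \<open>CPmem\<close>, and remove it by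
      \<open>*\<close>.\<close>
    by (metis * CPmem)
qed

lemma dj_cj_cond: "(x \<squnion> y) \<sqinter> z = z \<triangleleft> x \<triangleright> (z \<triangleleft> y \<triangleright> fa)"
  by (simp add: dj_eq cj_eq CP4 CP1)

lemma cp_mem: "(x \<squnion> y) \<sqinter> z = (\<ominus> x \<sqinter> (y \<sqinter> z)) \<squnion> (x \<sqinter> z)"
proof -
  have "(\<ominus> x \<sqinter> (y \<sqinter> z)) \<squnion> (x \<sqinter> z)
      = (z \<triangleleft> x \<triangleright> fa) \<triangleleft> x \<triangleright> ((tr \<triangleleft> z \<triangleright> (z \<triangleleft> x \<triangleright> fa)) \<triangleleft> y \<triangleright> (z \<triangleleft> x \<triangleright> fa))"
    by (simp add: dj_eq cj_eq cond_ng CP4 CP2)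
  \<comment> \<open>Once \<open>x\<close> has been false, each inner
    \<open>z \<triangleleft> x \<triangleright> fa\<close> becomes \<open>fa\<close>, and
    \<open>tr \<triangleleft> z \<triangleright> fa\<close> is \<open>z\<close>.\<close>
  also have "\<dots> = z \<triangleleft> x \<triangleright> (z \<triangleleft> y \<triangleright> fa)"
    by (simp add: CPmem_left CPmem_deep CPmem CP3)
  finally show ?thesis by (simp add: dj_cj_cond)
qed

lemma mscl_algebra: "mscl_algebra tr fa (\<lambda>x. \<ominus> x) (\<sqinter>) (\<squnion>)"
proof
  show "fa = \<ominus> tr" by (simp add: ng_eq CP1)
  show "x \<squnion> y = \<ominus> (\<ominus> x \<sqinter> \<ominus> y)" for x y
    by (simp add: dj_eq ng_eq cj_eq CP4 CP1 CP2 CP3)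
  show "tr \<sqinter> x = x" for x by (simp add: cj_eq CP1)
  show "x \<sqinter> (x \<squnion> y) = x" for x y by (simp add: cj_eq dj_eq CPmem_left CP3)
qed (rule cp_mem)

section \<open>Evaluation and soundness for terms with the conditional\<close>

primrec ceval :: "('a \<Rightarrow> 'b) \<Rightarrow> (nat \<Rightarrow> 'b) \<Rightarrow> 'a cscl \<Rightarrow> 'b" where
  "ceval \<alpha> \<rho> (CVar n) = \<rho> n"
| "ceval \<alpha> \<rho> (CAtom a) = \<alpha> a"
| "ceval \<alpha> \<rho> CTrue = tr"
| "ceval \<alpha> \<rho> CFalse = fa"
| "ceval \<alpha> \<rho> (CNeg s) = \<ominus> ceval \<alpha> \<rho> s"
| "ceval \<alpha> \<rho> (CAnd s t) = ceval \<alpha> \<rho> s \<sqinter> ceval \<alpha> \<rho> t"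
| "ceval \<alpha> \<rho> (COr s t) = ceval \<alpha> \<rho> s \<squnion> ceval \<alpha> \<rho> t"
| "ceval \<alpha> \<rho> (Cond s t u) = ceval \<alpha> \<rho> s \<triangleleft> ceval \<alpha> \<rho> t \<triangleright> ceval \<alpha> \<rho> u"

lemma ceval_subst: "ceval \<alpha> \<rho> (cscl_subst \<sigma> s) = ceval \<alpha> (\<lambda>n. ceval \<alpha> \<rho> (\<sigma> n)) s"
  by (induction s) simp_all

lemma ceval_sound:
  "cscl_derives MSCL_axioms s t \<Longrightarrow> ceval \<alpha> \<rho> s = ceval \<alpha> \<rho> t"
proof (induction arbitrary: \<rho> rule: cscl_derives.induct)
  case (cscl_axiom s t)
  then show ?case
    by (auto simp: MSCL_axioms_def Let_def intro: CP1 CP2 CP3 CP4 CPmem ng_eq cj_eq dj_eq)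
qed (simp_all add: ceval_subst)

end

section \<open>The conditional axioms from EqMSCL\<close>

lemma (in mscl_algebra) cp_algebra: "cp_algebra tr fa (\<lambda>x. \<ominus> x) (\<sqinter>) (\<squnion>) cond"
proof
  show "x \<triangleleft> tr \<triangleright> y = x" for x y
    by (simp add: cond_def Tand fa_cj dj_fa flip: Neg)
  show "x \<triangleleft> fa \<triangleright> y = y" for x y
    by (simp add: cond_def fa_cj fa_dj) (simp add: Neg Tand)
  show "tr \<triangleleft> x \<triangleright> fa = x" for x
    by (simp add: cond_def cj_tr ng_cj_fa dj_absorb)
  show "\<ominus> x = fa \<triangleleft> x \<triangleright> tr" for x
    by (simp add: cond_def cj_tr cj_fa_dj_ng)
  show "x \<sqinter> y = y \<triangleleft> x \<triangleright> fa" for x y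
    by (simp add: cond_def ng_cj_fa cj_dj_cj_fa)
  show "x \<squnion> y = tr \<triangleleft> x \<triangleright> y" for x y
    by (simp add: cond_def cj_tr dj_ng_cj)
  show "x \<triangleleft> (y \<triangleleft> z \<triangleright> u) \<triangleright> v = (x \<triangleleft> y \<triangleright> v) \<triangleleft> z \<triangleright> (x \<triangleleft> u \<triangleright> v)" for x y z u v
  proof -
    have "x \<triangleleft> (y \<triangleleft> z \<triangleright> u) \<triangleright> v
        = ((y \<triangleleft> z \<triangleright> u) \<sqinter> x) \<squnion> ((\<ominus> y \<triangleleft> z \<triangleright> \<ominus> u) \<sqinter> v)"
      by (simp only: cond_def[of x] ng_cond)
    also have "\<dots> = ((y \<sqinter> x) \<squnion> (\<ominus> y \<sqinter> v)) \<triangleleft> z \<triangleright> ((u \<sqinter> x) \<squnion> (\<ominus> u \<sqinter> v))"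
      by (simp only: cond_cj cond_dj_cond)
    finally show ?thesis by (simp only: cond_def[of x])
  qed
  show "x \<triangleleft> y \<triangleright> (z \<triangleleft> u \<triangleright> (v \<triangleleft> y \<triangleright> w)) = x \<triangleleft> y \<triangleright> (z \<triangleleft> u \<triangleright> w)" for x y z u v w
  proof -
    \<comment> \<open>The falsity of \<open>y\<close> is remembered past \<open>u\<close> and
      \<open>\<ominus> u\<close>, so the inner conditional on \<open>y\<close> reduces to
      \<open>w\<close>.\<close>
    have "\<ominus> y \<sqinter> (z \<triangleleft> u \<triangleright> (v \<triangleleft> y \<triangleright> w)) = \<ominus> y \<sqinter> (z \<triangleleft> u \<triangleright> w)"
      by (simp only: cond_def[of z] cj_dj_distrib ng_cj_cj_cond)
    then show ?thesis by (simp only: cond_def[of x])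
  qed
qed

lemma (in cp_algebra) ceval_incl:
  "ceval \<alpha> \<rho> (scl_incl s) = mscl_algebra.eval tr fa (\<lambda>x. \<ominus> x) (\<sqinter>) (\<squnion>) \<alpha> \<rho> s"
  by (induction s) (simp_all add: mscl_algebra.eval.simps[OF mscl_algebra])

section \<open>Term algebras modulo derivability\<close>

quotient_type 'a mscl = "'a scl" / "scl_derives EqMSCL"
  by (rule equivpI; blast intro: reflpI sympI transpI scl_refl scl_sym scl_trans)

lift_definition mscl_var :: "nat \<Rightarrow> 'a mscl" is SVar .
lift_definition mscl_atom :: "'a \<Rightarrow> 'a mscl" is SAtom .
lift_definition mscl_true :: "'a mscl" is STrue .
lift_definition mscl_false :: "'a mscl" is SFalse .
lift_definition mscl_neg :: "'a mscl \<Rightarrow> 'a mscl" is SNeg by (rule scl_cong_neg)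
lift_definition mscl_and :: "'a mscl \<Rightarrow> 'a mscl \<Rightarrow> 'a mscl" is SAnd by (rule scl_cong_and)
lift_definition mscl_or :: "'a mscl \<Rightarrow> 'a mscl \<Rightarrow> 'a mscl" is SOr by (rule scl_cong_or)

text \<open>The variable \<open>E\<close> keeps the simplifier from unfolding the axiom set inside the derivability
  predicate; likewise for MSCL below.\<close>

lemma scl_derives_EqMSCL:
  assumes "E = EqMSCL"
  shows "scl_derives E SFalse (SNeg STrue)"
    and "scl_derives E (x \<or>\<^sub>s y) (SNeg (SNeg x \<and>\<^sub>s SNeg y))"
    and "scl_derives E (STrue \<and>\<^sub>s x) x"
    and "scl_derives E (x \<and>\<^sub>s (x \<or>\<^sub>s y)) x"
    and "scl_derives E ((x \<or>\<^sub>s y) \<and>\<^sub>s z) ((SNeg x \<and>\<^sub>s (y \<and>\<^sub>s z)) \<or>\<^sub>s (x \<and>\<^sub>s z))"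
proof -
  \<comment> \<open>The axioms contain the variables 0, 1 and 2 only, so indexing into this list is
    defined wherever it is evaluated.\<close>
  let ?\<sigma> = "(!) [x, y, z]"
  have "\<forall>(s, t) \<in> EqMSCL. scl_derives E (scl_subst ?\<sigma> s) (scl_subst ?\<sigma> t)"
    using assms by (auto intro: scl_inst scl_axiom)
  then show "scl_derives E SFalse (SNeg STrue)"
    and "scl_derives E (x \<or>\<^sub>s y) (SNeg (SNeg x \<and>\<^sub>s SNeg y))"
    and "scl_derives E (STrue \<and>\<^sub>s x) x"
    and "scl_derives E (x \<and>\<^sub>s (x \<or>\<^sub>s y)) x"
    and "scl_derives E ((x \<or>\<^sub>s y) \<and>\<^sub>s z) ((SNeg x \<and>\<^sub>s (y \<and>\<^sub>s z)) \<or>\<^sub>s (x \<and>\<^sub>s z))"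
    by (simp_all add: EqMSCL_def Let_def)
qed

interpretation mscl: mscl_algebra mscl_true mscl_false mscl_neg mscl_and mscl_or
  by unfold_locales (transfer, rule scl_derives_EqMSCL[OF refl])+

lemma eval_mscl: "mscl.eval mscl_atom mscl_var s = abs_mscl s"
  by (induction s)
    (simp_all flip: mscl_var.abs_eq mscl_atom.abs_eq mscl_true.abs_eq mscl_false.abs_eq
      mscl_neg.abs_eq mscl_and.abs_eq mscl_or.abs_eq)

\<comment> \<open>The term model of MSCL\<close>
quotient_type 'a cmscl = "'a cscl" / "cscl_derives MSCL_axioms"
  by (rule equivpI; blast intro: reflpI sympI transpI cscl_refl cscl_sym cscl_trans)

lift_definition cmscl_var :: "nat \<Rightarrow> 'a cmscl" is CVar .
lift_definition cmscl_atom :: "'a \<Rightarrow> 'a cmscl" is CAtom .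
lift_definition cmscl_true :: "'a cmscl" is CTrue .
lift_definition cmscl_false :: "'a cmscl" is CFalse .
lift_definition cmscl_neg :: "'a cmscl \<Rightarrow> 'a cmscl" is CNeg by (rule cscl_cong_neg)
lift_definition cmscl_and :: "'a cmscl \<Rightarrow> 'a cmscl \<Rightarrow> 'a cmscl" is CAnd by (rule cscl_cong_and)
lift_definition cmscl_or :: "'a cmscl \<Rightarrow> 'a cmscl \<Rightarrow> 'a cmscl" is COr by (rule cscl_cong_or)
lift_definition cmscl_cond :: "'a cmscl \<Rightarrow> 'a cmscl \<Rightarrow> 'a cmscl \<Rightarrow> 'a cmscl" is Cond
  by (rule cscl_cong_cond)

lemma cscl_derives_MSCL:
  assumes "E = MSCL_axioms"
  shows "cscl_derives E (x \<lhd> CTrue \<rhd> y) x"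
    and "cscl_derives E (x \<lhd> CFalse \<rhd> y) y"
    and "cscl_derives E (CTrue \<lhd> x \<rhd> CFalse) x"
    and "cscl_derives E (x \<lhd> (y \<lhd> z \<rhd> u) \<rhd> v) ((x \<lhd> y \<rhd> v) \<lhd> z \<rhd> (x \<lhd> u \<rhd> v))"
    and "cscl_derives E (x \<lhd> y \<rhd> (z \<lhd> u \<rhd> (v \<lhd> y \<rhd> w))) (x \<lhd> y \<rhd> (z \<lhd> u \<rhd> w))"
    and "cscl_derives E (CNeg x) (CFalse \<lhd> x \<rhd> CTrue)"
    and "cscl_derives E (x \<and>\<^sub>c y) (y \<lhd> x \<rhd> CFalse)"
    and "cscl_derives E (x \<or>\<^sub>c y) (CTrue \<lhd> x \<rhd> y)"
proof -
  let ?\<sigma> = "(!) [x, y, z, u, v, w]"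
  have "\<forall>(s, t) \<in> MSCL_axioms. cscl_derives E (cscl_subst ?\<sigma> s) (cscl_subst ?\<sigma> t)"
    using assms by (auto intro: cscl_inst cscl_axiom)
  then show "cscl_derives E (x \<lhd> CTrue \<rhd> y) x"
    and "cscl_derives E (x \<lhd> CFalse \<rhd> y) y"
    and "cscl_derives E (CTrue \<lhd> x \<rhd> CFalse) x"
    and "cscl_derives E (x \<lhd> (y \<lhd> z \<rhd> u) \<rhd> v) ((x \<lhd> y \<rhd> v) \<lhd> z \<rhd> (x \<lhd> u \<rhd> v))"
    and "cscl_derives E (x \<lhd> y \<rhd> (z \<lhd> u \<rhd> (v \<lhd> y \<rhd> w))) (x \<lhd> y \<rhd> (z \<lhd> u \<rhd> w))"
    and "cscl_derives E (CNeg x) (CFalse \<lhd> x \<rhd> CTrue)"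
    and "cscl_derives E (x \<and>\<^sub>c y) (y \<lhd> x \<rhd> CFalse)"
    and "cscl_derives E (x \<or>\<^sub>c y) (CTrue \<lhd> x \<rhd> y)"
    by (simp_all add: MSCL_axioms_def Let_def)
qed

interpretation cmscl: cp_algebra cmscl_true cmscl_false cmscl_neg cmscl_and cmscl_or cmscl_cond
  by unfold_locales (transfer, rule cscl_derives_MSCL[OF refl])+

lemma ceval_cmscl: "cmscl.ceval cmscl_atom cmscl_var s = abs_cmscl s"
  by (induction s)
    (simp_all flip: cmscl_var.abs_eq cmscl_atom.abs_eq cmscl_true.abs_eq cmscl_false.abs_eq
      cmscl_neg.abs_eq cmscl_and.abs_eq cmscl_or.abs_eq cmscl_cond.abs_eq)

section \<open>Equivalence of the two derivability relations\<close>

theorem theorem5p5: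
  fixes s t :: "'a scl"
  shows "EqMSCL_proves s t \<longleftrightarrow> MSCL_proves s t"
proof
  assume "EqMSCL_proves s t"
  then have "scl_derives EqMSCL s t" by (simp add: EqMSCL_proves_def)
  then have "cmscl.ceval cmscl_atom cmscl_var (scl_incl s)
      = cmscl.ceval cmscl_atom cmscl_var (scl_incl t)"
    unfolding cmscl.ceval_incl by (rule mscl_algebra.eval_sound[OF cmscl.mscl_algebra])
  then show "MSCL_proves s t"
    by (simp add: ceval_cmscl cmscl.abs_eq_iff MSCL_proves_def)
next
  \<comment> \<open>The hidden operator is interpreted by \<open>mscl.cond\<close> on classes of
    terms without it, so a derivation may pass through arbitrary terms of the extended
    signature.\<close>
  interpret cond: cp_algebra mscl_true mscl_false mscl_neg mscl_and mscl_or
    "mscl.cond :: 'a mscl \<Rightarrow> _"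
    by (rule mscl.cp_algebra)
  assume "MSCL_proves s t"
  then have "cscl_derives MSCL_axioms (scl_incl s) (scl_incl t)" by (simp add: MSCL_proves_def)
  then have "mscl.eval mscl_atom mscl_var s = mscl.eval mscl_atom mscl_var t"
    unfolding cond.ceval_incl[symmetric] by (rule cond.ceval_sound)
  then show "EqMSCL_proves s t"
    by (simp add: eval_mscl mscl.abs_eq_iff EqMSCL_proves_def)
qed

end
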